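(* Let $\mathcal H$ be a real Hilbert space, let $g,h:\mathcal H\to(-\infty,\infty]$ be proper, lower semicontinuous and convex, and let $f:=g-h$. Assume that $\operatorname{dom}h=\mathcal H$, that $h$ is bounded on bounded subsets of $\mathcal H$, and that $\inf_{u\in\mathcal H}f(u)>-\infty$. Let the function $h$ be continuous. At each iteration $k\ge 0$ of Algorithm I-ADCA (described in the context), if the point $w^k$ chosen in Step 1 is not a critical point of the problem $\inf_{u\in\mathcal H}f(u)$, then the adaptive process of Step 4 (repeated replacement $\varepsilon_k\gets\gamma\varepsilon_k$ and return to Step 2) terminates after a finite number of steps. Consequently, the resulting $\varepsilon_k$ and $u^{k+1}$ satisfy $$\varepsilon_k\le\frac{\sigma_g+\sigma_h}{32}\,\|u^{k+1}-w^k\|^2 .$$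
   Context: For a convex function $\varphi$ on $\mathcal H$, $\sigma_\varphi$ denotes its modulus of strong convexity: the supremum of all $\sigma\ge0$ such that $\varphi(\lambda x+(1-\lambda)y)\le\lambda\varphi(x)+(1-\lambda)\varphi(y)-\frac{\sigma}{2}\lambda(1-\lambda)\|x-y\|^2$ for all $x,y\in\mathcal H$, $\lambda\in[0,1]$. For $\varepsilon\ge 0$ and $u\in\operatorname{dom}\varphi:=\{u\in\mathcal H:\varphi(u)<\infty\}$, $\partial_\varepsilon\varphi(u):=\{v\in\mathcal H:\langle v,u'-u\rangle\le\varphi(u')-\varphi(u)+\varepsilon\ \ \forall u'\in\mathcal H\}$, and $\partial\varphi:=\partial_0\varphi$ is the convex subdifferential. A point $u$ is a critical point of $\inf_{\mathcal H}(g-h)$ if $\partial g(u)\cap\partial h(u)\ne\varnothing$. A point $u_\varepsilon$ is an $\varepsilon$-solution of $\inf_{u\in\mathcal H}\varphi(u)$ if $\varphi(u_\varepsilon)\le\inf_{\mathcal H}\varphi+\varepsilon$. Algorithm I-ADCA. Initialization: $u^0\in\operatorname{dom}f$, a reduction factor $\gamma\in(0,1)$, $\varepsilon_0\in(0,1]$, $k=0$. Repeat: Step 1: choose $w^k$ with $f(w^k)\le f(u^k)$. Step 2: compute $v^k\in\partial_{\varepsilon_k}h(w^k)$. Step 3: compute an $\varepsilon_k$-solution $u^{k+1}$ of $\inf_{u\in\mathcal H}[g(u)-\langle v^k,u\rangle]$. Step 4: while $\varepsilon_k>\frac{\sigma_g+\sigma_h}{32}\|u^{k+1}-w^k\|^2$,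 set $\varepsilon_k\gets\gamma\varepsilon_k$ and restart from Step 2 with the new $\varepsilon_k$. Step 5: choose $\varepsilon_{k+1}\in(0,\varepsilon_k]$ and set $k\gets k+1$. The algorithm runs until a stopping criterion is met.
   Formalization: The assumption σ_g+σ_h>0 is added; without it the Step 4 test ε_k>0 always succeeds and the loop never ends, e.g. H=ℝ, g=|·|, h=0, w^0=u^0=1, which is not critical. *)

theory Defs
  imports "HOL-Analysis.Analysis"
begin

text \<open>Functions with values in \<open>(-\<infinity>, \<infinity>]\<close> are \<open>ereal\<close>-valued functions that never take the
  value \<open>-\<infinity>\<close>; the latter is part of \<open>proper_fun\<close>.\<close>

definition edom :: "('a \<Rightarrow> ereal) \<Rightarrow> 'a set" where
  "edom \<phi> = {u. \<phi> u < \<infinity>}"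

definition proper_fun :: "('a \<Rightarrow> ereal) \<Rightarrow> bool" where
  "proper_fun \<phi> \<longleftrightarrow> (\<forall>u. \<phi> u \<noteq> -\<infinity>) \<and> edom \<phi> \<noteq> {}"

definition lsc_fun :: "('a::topological_space \<Rightarrow> ereal) \<Rightarrow> bool" where
  "lsc_fun \<phi> \<longleftrightarrow> (\<forall>x. \<phi> x \<le> Liminf (at x) \<phi>)"

text \<open>At \<open>t = 0\<close> and \<open>t = 1\<close> the next two definitions rely on \<open>0 * \<infinity> = 0\<close>, which holds in
  \<open>ereal\<close> and makes the inequalities trivial there.\<close>

definition convex_fun :: "('a::real_vector \<Rightarrow> ereal) \<Rightarrow> bool" where
  "convex_fun \<phi> \<longleftrightarrow> (\<forall>x y. \<forall>t\<in>{0..1}.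
     \<phi> (t *\<^sub>R x + (1 - t) *\<^sub>R y) \<le> ereal t * \<phi> x + ereal (1 - t) * \<phi> y)"

definition strong_convexity_modulus :: "('a::real_normed_vector \<Rightarrow> ereal) \<Rightarrow> ereal" where
  "strong_convexity_modulus \<phi> = Sup {ereal \<sigma> | \<sigma>::real. \<sigma> \<ge> 0 \<and> (\<forall>x y. \<forall>t\<in>{0..1}.
     \<phi> (t *\<^sub>R x + (1 - t) *\<^sub>R y)
       \<le> ereal t * \<phi> x + ereal (1 - t) * \<phi> y
          - ereal (\<sigma> / 2 * t * (1 - t) * (norm (x - y))\<^sup>2))}"

text \<open>Empty outside the domain of \<open>\<phi>\<close>, as usual.\<close>

definition eps_subdifferential :: "real \<Rightarrow> ('a::real_inner \<Rightarrow> ereal) \<Rightarrow> 'a \<Rightarrow> 'a set" where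
  "eps_subdifferential \<epsilon> \<phi> u =
     {v. u \<in> edom \<phi> \<and> (\<forall>u'. ereal (inner v (u' - u)) \<le> \<phi> u' - \<phi> u + ereal \<epsilon>)}"

abbreviation subdifferential :: "('a::real_inner \<Rightarrow> ereal) \<Rightarrow> 'a \<Rightarrow> 'a set" where
  "subdifferential \<equiv> eps_subdifferential 0"

definition critical_point :: "('a::real_inner \<Rightarrow> ereal) \<Rightarrow> ('a \<Rightarrow> ereal) \<Rightarrow> 'a \<Rightarrow> bool" where
  "critical_point g h u \<longleftrightarrow> subdifferential g u \<inter> subdifferential h u \<noteq> {}"

definition eps_solution :: "real \<Rightarrow> ('a \<Rightarrow> ereal) \<Rightarrow> 'a \<Rightarrow> bool" where
  "eps_solution \<epsilon> \<phi> u \<longleftrightarrow> \<phi> u \<le> (INF u'. \<phi> u') + ereal \<epsilon>"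

text \<open>Algorithm I-ADCA as a nondeterministic transition system. A state records the next step to
  be executed, the iteration counter \<open>k\<close> and the current values of the live variables:
  \<^item> \<open>Step1 k u \<epsilon>\<close>: \<open>u = u\<^sup>k\<close>, \<open>\<epsilon> = \<epsilon>\<^sub>k\<close>;
  \<^item> \<open>Step2 k w \<epsilon>\<close>: \<open>w = w\<^sup>k\<close>, \<open>\<epsilon>\<close> the current value of \<open>\<epsilon>\<^sub>k\<close>;
  \<^item> \<open>Step3 k w \<epsilon> v\<close>: additionally \<open>v = v\<^sup>k\<close>;
  \<^item> \<open>Step4 k w \<epsilon> u\<close> and \<open>Step5 k w \<epsilon> u\<close>: \<open>u\<close> is the current value of the next iterate
    (index \<open>k + 1\<close>).

  Every choice left open by the algorithm is a nondeterministic choice of the successor.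
  Stopping criteria are unspecified and not modelled: runs may be observed up to any point.\<close>

datatype 'a iadca_state =
    Step1 nat 'a real
  | Step2 nat 'a real
  | Step3 nat 'a real 'a
  | Step4 nat 'a real 'a
  | Step5 nat 'a real 'a

definition step4_threshold ::
    "('a::real_inner \<Rightarrow> ereal) \<Rightarrow> ('a \<Rightarrow> ereal) \<Rightarrow> 'a \<Rightarrow> 'a \<Rightarrow> ereal" where
  "step4_threshold g h w u =
     (strong_convexity_modulus g + strong_convexity_modulus h) / 32 * ereal ((norm (u - w))\<^sup>2)"

inductive iadca_step ::
    "('a::real_inner \<Rightarrow> ereal) \<Rightarrow> ('a \<Rightarrow> ereal) \<Rightarrow> real \<Rightarrow> 'a iadca_state \<Rightarrow> 'a iadca_state \<Rightarrow> bool"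
  for g h :: "'a \<Rightarrow> ereal" and \<gamma> :: real where
  choose_w: "g w - h w \<le> g u - h u \<Longrightarrow>
    iadca_step g h \<gamma> (Step1 k u \<epsilon>) (Step2 k w \<epsilon>)"
| compute_v: "v \<in> eps_subdifferential \<epsilon> h w \<Longrightarrow>
    iadca_step g h \<gamma> (Step2 k w \<epsilon>) (Step3 k w \<epsilon> v)"
| compute_u: "eps_solution \<epsilon> (\<lambda>x. g x - ereal (inner v x)) u \<Longrightarrow>
    iadca_step g h \<gamma> (Step3 k w \<epsilon> v) (Step4 k w \<epsilon> u)"
| restart: "ereal \<epsilon> > step4_threshold g h w u \<Longrightarrow>
    iadca_step g h \<gamma> (Step4 k w \<epsilon> u) (Step2 k w (\<gamma> * \<epsilon>))"
| accept: "\<not> ereal \<epsilon> > step4_threshold g h w u \<Longrightarrow>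
    iadca_step g h \<gamma> (Step4 k w \<epsilon> u) (Step5 k w \<epsilon> u)"
| next_iteration: "0 < \<epsilon>' \<Longrightarrow> \<epsilon>' \<le> \<epsilon> \<Longrightarrow>
    iadca_step g h \<gamma> (Step5 k w \<epsilon> u) (Step1 (Suc k) u \<epsilon>')"

text \<open>\<open>inevitably R P s\<close>: every execution of the transition relation \<open>R\<close> from \<open>s\<close>, whatever the
  choices made, arrives at a state satisfying \<open>P\<close> after finitely many steps. Because the predicate
  is inductive, there is no infinite \<open>P\<close>-avoiding execution; the premise \<open>\<exists>t. R s t\<close> moreover
  rules out executions that get stuck before \<open>P\<close> holds.\<close>

inductive inevitably :: "('s \<Rightarrow> 's \<Rightarrow> bool) \<Rightarrow> ('s \<Rightarrow> bool) \<Rightarrow> 's \<Rightarrow> bool"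
  for R :: "'s \<Rightarrow> 's \<Rightarrow> bool" and P :: "'s \<Rightarrow> bool" where
  reached: "P s \<Longrightarrow> inevitably R P s"
| progress: "\<exists>t. R s t \<Longrightarrow> (\<And>t. R s t \<Longrightarrow> inevitably R P t) \<Longrightarrow> inevitably R P s"

end

theory Submission
  imports Defs
begin

text \<open>In a Hilbert space a decreasing sequence of nonempty bounded closed convex sets has a common
  point, because the points of almost minimal norm form a nest of vanishing diameter. Applied to
  \<open>\<partial>\<^sub>\<delta>g(w) \<inter> \<partial>\<^sub>\<delta>h(w)\<close> with \<open>\<delta> \<rightarrow> 0\<close>, this shows that these sets are empty for some \<open>\<delta> > 0\<close> when \<open>w\<close>
  is not critical. If Step 4 rejects \<open>\<epsilon>\<close>, then the squared distance from \<open>u\<close> to \<open>w\<close> is \<open>O(\<epsilon>)\<close>, so for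
  small \<open>\<epsilon>\<close> lower semicontinuity of \<open>g\<close> and boundedness of \<open>\<partial>\<^sub>\<epsilon>h(w)\<close> turn \<open>v \<in> \<partial>\<^sub>\<epsilon>g(u)\<close> into
  \<open>v \<in> \<partial>\<^sub>\<delta>g(w)\<close>, a contradiction. Hence no restart happens once \<open>\<epsilon>\<close> is small. The run never gets
  stuck: \<open>\<partial>\<^sub>\<epsilon>h(w)\<close> is nonempty, and \<open>v \<in> \<partial>\<^sub>\<epsilon>h(w)\<close> bounds \<open>g - \<langle>v, \<cdot>\<rangle>\<close> below by \<open>inf (g - h)\<close> plus a
  constant.\<close>

section \<open>Intersections of nested closed convex sets in Hilbert space\<close>

lemma nested_closed_convex_common_point:
  fixes K :: "nat \<Rightarrow> 'a::{real_inner,complete_space} set"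
  assumes closed: "\<And>n. closed (K n)" and convex: "\<And>n. convex (K n)"
    and nonempty: "\<And>n. K n \<noteq> {}" and dec: "\<And>m n. m \<le> n \<Longrightarrow> K n \<subseteq> K m"
    and bdd: "bounded (K 0)"
  obtains a where "\<And>n. a \<in> K n"
proof -
  obtain B where B: "\<And>x. x \<in> K 0 \<Longrightarrow> norm x \<le> B"
    using bdd by (auto simp: bounded_iff)
  define m where "m n = (INF x\<in>K n. (norm x)\<^sup>2)" for n
  have bdd_below: "bdd_below ((\<lambda>x. (norm x)\<^sup>2) ` K n)" for n
    by (rule bdd_belowI[of _ 0]) auto
  have m_le: "m n \<le> (norm x)\<^sup>2" if "x \<in> K n" for n x
    unfolding m_def using bdd_below that by (rule cINF_lower)
  have "m n \<le> B\<^sup>2" for n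
  proof -
    obtain x where x: "x \<in> K n" using nonempty by blast
    then have "norm x \<le> B" using dec[of 0 n] B by blast
    then have "(norm x)\<^sup>2 \<le> B\<^sup>2" by (intro power_mono) auto
    then show ?thesis using m_le[OF x] by linarith
  qed
  then have bdd_m: "bdd_above (range m)" by (intro bdd_aboveI[of _ "B\<^sup>2"]) auto
  define M where "M = (SUP n. m n)"
  have m_M: "m n \<le> M" for n unfolding M_def using bdd_m by (rule cSUP_upper2) auto
  have m_mono: "m i \<le> m j" if "i \<le> j" for i j
    unfolding m_def using dec[OF that] nonempty bdd_below by (intro cINF_superset_mono) auto
  \<comment> \<open>\<open>M\<close> is the limit of the increasing infimal squared norms
    \<open>m n\<close>, so the slack 1/(n+1) keeps every slice nonempty.\<close>
  define S where "S n = {x \<in> K n. (norm x)\<^sup>2 \<le> M + 1 / Suc n}" for n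
  have "closed (S n)" for n
    unfolding S_def using closed
    by (intro closed_Collect_conj) (auto intro!: closed_Collect_le continuous_intros)
  moreover have "S n \<noteq> {}" for n
  proof -
    have "m n < M + 1 / Suc n"
      using m_M[of n] by (simp add: add_pos_pos less_add_same_cancel1 order_le_less_trans)
    then obtain x where "x \<in> K n" "(norm x)\<^sup>2 < M + 1 / Suc n"
      unfolding m_def using nonempty bdd_below by (auto simp: cINF_less_iff)
    then show ?thesis unfolding S_def by force
  qed
  moreover have "S j \<subseteq> S i" if "i \<le> j" for i j
  proof -
    have "1 / real (Suc j) \<le> 1 / real (Suc i)" using that by (intro divide_left_mono) auto
    then show ?thesis unfolding S_def using dec[OF that] by (auto simp del: of_nat_Suc)
  qed
  moreover have "\<exists>n. \<forall>x\<in>S n. \<forall>y\<in>S n. dist x y < e" if "e > 0" for e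
  proof -
    \<comment> \<open>By the parallelogram law and the midpoint, which lies in \<open>K n\<close>,
      the squared distance of two points of \<open>S n\<close> is at most 4 (M - m n) + 4/(n+1).
      Keeping M - m n and 1/(n+1) both below e^2/8 makes this less than e^2.\<close>
    have e: "e\<^sup>2 / 8 > 0" using that by simp
    obtain i where i: "M - e\<^sup>2 / 8 < m i"
      using e less_cSUP_iff[OF _ bdd_m, of "M - e\<^sup>2 / 8"] unfolding M_def by auto
    obtain j where j: "1 / real (Suc j) < e\<^sup>2 / 8"
      using e nat_approx_posE by blast
    define n where "n = max i j"
    have i': "M - e\<^sup>2 / 8 < m n" using i m_mono[of i n] unfolding n_def by simp
    have "1 / real (Suc n) \<le> 1 / real (Suc j)"
      unfolding n_def by (intro divide_left_mono) auto
    then have j': "1 / real (Suc n) < e\<^sup>2 / 8" using j by linarith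
    have "dist x y < e" if x: "x \<in> S n" and y: "y \<in> S n" for x y
    proof -
      have "(1/2) *\<^sub>R x + (1/2) *\<^sub>R y \<in> K n"
        using convex[of n] x y unfolding S_def convex_def by auto
      then have "m n \<le> (norm ((1/2) *\<^sub>R x + (1/2) *\<^sub>R y))\<^sup>2" by (rule m_le)
      moreover have "(norm (x - y))\<^sup>2 + 4 * (norm ((1/2) *\<^sub>R x + (1/2) *\<^sub>R y))\<^sup>2
          = 2 * (norm x)\<^sup>2 + 2 * (norm y)\<^sup>2"
        by (simp add: power2_norm_eq_inner algebra_simps inner_commute)
      moreover have "(norm x)\<^sup>2 \<le> M + 1 / Suc n" "(norm y)\<^sup>2 \<le> M + 1 / Suc n"
        using x y unfolding S_def by auto
      ultimately have "(norm (x - y))\<^sup>2 < e\<^sup>2" using i' j' by argo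
      then show ?thesis using \<open>e > 0\<close> by (simp add: dist_norm power2_less_imp_less)
    qed
    then show ?thesis by blast
  qed
  ultimately obtain a where "\<And>n. a \<in> S n" using decreasing_closed_nest[of S] by metis
  then show ?thesis using that unfolding S_def by blast
qed

section \<open>Closedness, monotonicity and limits of \<epsilon>-subdifferentials\<close>

text \<open>Each test point contributes a closed half-space, or all or nothing when the right-hand
  side is infinite or trivial.\<close>

lemma eps_subdifferential_closed_convex:
  shows "closed (eps_subdifferential e \<phi> u)" and "convex (eps_subdifferential e \<phi> u)"
proof -
  define A where "A x = {v. ereal (inner v (x - u)) \<le> \<phi> x - \<phi> u + ereal e}" for x
  have A: "closed (A x) \<and> convex (A x)" for x
  proof (cases "\<phi> x - \<phi> u + ereal e")
    case (real r)
    then have "A x = {v. inner (x - u) v \<le> r}" unfolding A_def by (simp add: inner_commute)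
    then show ?thesis by (simp add: closed_halfspace_le convex_halfspace_le)
  qed (auto simp: A_def)
  have eq: "eps_subdifferential e \<phi> u = (if u \<in> edom \<phi> then \<Inter>x. A x else {})"
    unfolding eps_subdifferential_def A_def by auto
  show "closed (eps_subdifferential e \<phi> u)" unfolding eq using A by (auto intro!: closed_INT)
  show "convex (eps_subdifferential e \<phi> u)" unfolding eq using A by (auto intro!: convex_INT)
qed

lemma eps_subdifferential_mono:
  "e \<le> e' \<Longrightarrow> eps_subdifferential e \<phi> u \<subseteq> eps_subdifferential e' \<phi> u"
  unfolding eps_subdifferential_def
  by (clarsimp, meson add_left_mono ereal_less_eq(3) order_trans)

text \<open>The slack tends to 0 in each inequality separately. This turns a common point of the
  nest into an exact subgradient.\<close>

lemma subdifferential_eq_INT: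
  assumes "\<And>n. v \<in> eps_subdifferential (1 / Suc n) \<phi> u"
  shows "v \<in> subdifferential \<phi> u"
proof -
  have "ereal (inner v (x - u)) \<le> \<phi> x - \<phi> u + ereal 0" for x
  proof -
    have le: "ereal (inner v (x - u)) \<le> \<phi> x - \<phi> u + ereal (1 / Suc n)" for n
      using assms[of n] unfolding eps_subdifferential_def by auto
    show ?thesis
    proof (cases "\<phi> x - \<phi> u")
      case (real r)
      have le_r: "inner v (x - u) - r \<le> 1 / Suc n" for n using le[of n] unfolding real by simp
      have "inner v (x - u) \<le> r"
      proof (rule ccontr)
        assume "\<not> inner v (x - u) \<le> r"
        then obtain n where "1 / real (Suc n) < inner v (x - u) - r"
          using nat_approx_posE[of "inner v (x - u) - r"] by auto
        then show False using le_r[of n] by simp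
      qed
      then show ?thesis unfolding real by simp
    qed (use le[of 0] in auto)
  qed
  then show ?thesis using assms[of 0] unfolding eps_subdifferential_def by auto
qed

section \<open>Existence of \<epsilon>-subgradients by a proximal step\<close>

text \<open>The sublevel sets at the infimum plus 1/(n+1) form a nest of bounded closed convex sets
  whose common points are the minimisers. This takes the place of a weak compactness
  argument.\<close>

lemma convex_sublevel_bounded_attains_min:
  fixes F :: "'a::{real_inner,complete_space} \<Rightarrow> real"
  assumes conv: "convex_on UNIV F" and cont: "continuous_on UNIV F"
    and coercive: "\<And>c. bounded {x. F x \<le> c}" and below: "\<And>x. b \<le> F x"
  obtains p where "\<And>x. F p \<le> F x"
proof -
  define m where "m = (INF x. F x)"
  have bdd: "bdd_below (range F)" using below by (intro bdd_belowI[of _ b]) auto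
  define K where "K n = {x. F x \<le> m + 1 / Suc n}" for n
  have "closed (K n)" for n
    unfolding K_def using cont by (intro closed_Collect_le) auto
  moreover have "convex (K n)" for n
    unfolding convex_def
  proof clarify
    fix x y :: 'a and s t :: real
    assume xy: "x \<in> K n" "y \<in> K n" and st: "0 \<le> s" "0 \<le> t" "s + t = 1"
    have "F (s *\<^sub>R x + t *\<^sub>R y) \<le> s * F x + t * F y"
      using conv st unfolding convex_on_def by auto
    also have "\<dots> \<le> m + 1 / Suc n"
      using xy st unfolding K_def by (intro convex_bound_le) auto
    finally show "s *\<^sub>R x + t *\<^sub>R y \<in> K n" unfolding K_def by simp
  qed
  moreover have "K n \<noteq> {}" for n
  proof -
    have "m < m + 1 / Suc n" by simp
    then obtain x where "F x < m + 1 / Suc n"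
      unfolding m_def using bdd by (subst (asm) cINF_less_iff) auto
    then show ?thesis unfolding K_def by (auto intro: less_imp_le)
  qed
  moreover have "K j \<subseteq> K i" if "i \<le> j" for i j
  proof -
    have "1 / real (Suc j) \<le> 1 / real (Suc i)" using that by (intro divide_left_mono) auto
    then show ?thesis unfolding K_def by auto
  qed
  moreover have "bounded (K 0)" unfolding K_def by (rule coercive)
  ultimately obtain p where p: "\<And>n. p \<in> K n"
    using nested_closed_convex_common_point[of K] by metis
  have "F p \<le> m"
  proof (rule ccontr)
    assume "\<not> F p \<le> m"
    then obtain n where "1 / real (Suc n) < F p - m"
      using nat_approx_posE[of "F p - m"] by auto
    then show False using p[of n] unfolding K_def by simp
  qed
  moreover have "m \<le> F x" for x unfolding m_def using bdd by (intro cINF_lower) auto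
  ultimately show ?thesis using that order_trans by blast
qed

text \<open>The witness is the proximal step: if \<open>p\<close> minimises \<open>H + a / 2 * \<parallel>\<cdot> - w\<parallel>\<^sup>2\<close>, then \<open>a (w - p)\<close>
  is a subgradient of \<open>H\<close> at \<open>p\<close>, and for large \<open>a\<close> an \<open>\<epsilon>\<close>-subgradient at \<open>w\<close>.\<close>

lemma convex_on_eps_subgradient_exists:
  fixes H :: "'a::{real_inner,complete_space} \<Rightarrow> real"
  assumes conv: "convex_on UNIV H" and cont: "continuous_on UNIV H"
    and sphere: "\<And>z. norm (z - w) = 1 \<Longrightarrow> H z \<le> M" and e: "e > 0"
  obtains v where "\<And>y. inner v (y - w) \<le> H y - H w + e"
proof -
  define L where "L = max 0 (M - H w)"
  have L0: "L \<ge> 0" unfolding L_def by simp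
  \<comment> \<open>\<open>L\<close> bounds the rise of \<open>H\<close> from \<open>w\<close> to
    the unit sphere around \<open>w\<close>. As \<open>w\<close> lies between \<open>y\<close> and
    the point \<open>z\<close> of that sphere opposite to \<open>y\<close>, the upper bound at
    \<open>z\<close> becomes a lower bound at \<open>y\<close>.\<close>
  have lower: "H y \<ge> H w - L * norm (y - w)" for y
  proof (cases "y = w")
    case False
    define d where "d = norm (y - w)"
    have d: "d > 0" using False unfolding d_def by simp
    define z where "z = w + (1 / d) *\<^sub>R (w - y)"
    have "norm (z - w) = 1"
      unfolding z_def using d by (simp add: d_def norm_minus_commute)
    then have Hz: "H z \<le> H w + L" using sphere[of z] unfolding L_def by simp
    have "(1 / (1 + d)) *\<^sub>R y + (d / (1 + d)) *\<^sub>R z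
        = (1 / (1 + d)) *\<^sub>R (y + d *\<^sub>R z)"
      by (simp add: scaleR_add_right)
    also have "y + d *\<^sub>R z = (1 + d) *\<^sub>R w"
      unfolding z_def using d by (simp add: algebra_simps)
    finally have w: "w = (1 / (1 + d)) *\<^sub>R y + (d / (1 + d)) *\<^sub>R z" using d by simp
    have "1 / (1 + d) + d / (1 + d) = 1" using d by (simp add: field_simps)
    then have "H w \<le> (1 / (1 + d)) * H y + (d / (1 + d)) * H z"
      using conv d unfolding convex_on_def
      by (metis UNIV_I divide_nonneg_pos add_pos_pos less_imp_le w zero_less_one)
    also have "\<dots> = (H y + d * H z) / (1 + d)" by (simp add: add_divide_distrib)
    finally have "(1 + d) * H w \<le> H y + d * H z" using d by (simp add: pos_le_divide_eq mult.commute)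
    also have "\<dots> \<le> H y + d * (H w + L)" using d Hz by simp
    finally show ?thesis unfolding d_def[symmetric] by (simp add: algebra_simps)
  qed simp
  \<comment> \<open>With this choice 4ae exceeds L^2, so e - L d + a d^2 has negative discriminant
    in \<open>d\<close> and is positive for every \<open>d\<close>.\<close>
  define a where "a = (L\<^sup>2 + 1) / (4 * e)"
  have a: "a > 0" unfolding a_def using e by (simp add: add_nonneg_pos)
  have ae: "4 * a * e = L\<^sup>2 + 1" unfolding a_def using e by simp
  define F where "F y = H y + a / 2 * (norm (y - w))\<^sup>2" for y
  have "convex_on UNIV (\<lambda>y. (norm (y - w))\<^sup>2)"
    unfolding convex_on_def
  proof clarsimp
    fix x y and s t :: real assume st: "0 \<le> s" "0 \<le> t" "s + t = 1"
    have t: "t = 1 - s" using st by simp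
    have "s * (norm (x - w))\<^sup>2 + t * (norm (y - w))\<^sup>2 - (norm (s *\<^sub>R x + t *\<^sub>R y - w))\<^sup>2
      = s * t * (norm (x - y))\<^sup>2"
      unfolding t by (simp add: power2_norm_eq_inner algebra_simps inner_commute)
    moreover have "s * t * (norm (x - y))\<^sup>2 \<ge> 0" using st by simp
    ultimately show "(norm (s *\<^sub>R x + t *\<^sub>R y - w))\<^sup>2
      \<le> s * (norm (x - w))\<^sup>2 + t * (norm (y - w))\<^sup>2" by linarith
  qed
  then have "convex_on UNIV F"
    unfolding F_def using conv a by (intro convex_on_add convex_on_cmul) auto
  moreover have "continuous_on UNIV F"
    unfolding F_def using cont by (intro continuous_intros)
  moreover have F_lower: "F y \<ge> H w - L * norm (y - w) + a / 2 * (norm (y - w))\<^sup>2" for y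
    unfolding F_def using lower[of y] by simp
  have "bounded {y. F y \<le> c}" for c
  proof -
    define C where "C = \<bar>c - H w\<bar>"
    have "norm (y - w) \<le> 1 + 2 * (L + C) / a" if "F y \<le> c" for y
    proof (cases "norm (y - w) \<le> 1")
      case True
      then show ?thesis using L0 a unfolding C_def by (simp add: add_increasing2)
    next
      case False
      define d where "d = norm (y - w)"
      have d: "d > 1" using False unfolding d_def by simp
      have "a / 2 * d\<^sup>2 \<le> L * d + C" using F_lower[of y] that unfolding d_def C_def by linarith
      also have "\<dots> \<le> (L + C) * d"
        using d mult_left_mono[of 1 d C] unfolding C_def by (simp add: distrib_right)
      finally have "a / 2 * d \<le> L + C" using d by (simp add: power2_eq_square)
      then have "d \<le> 2 * (L + C) / a" using a by (simp add: field_simps)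
      then show ?thesis unfolding d_def by simp
    qed
    then have "{y. F y \<le> c} \<subseteq> cball w (1 + 2 * (L + C) / a)"
      by (auto simp: dist_norm norm_minus_commute)
    then show ?thesis using bounded_cball bounded_subset by blast
  qed
  moreover have "H w - L\<^sup>2 / (2 * a) \<le> F y" for y
  proof -
    \<comment> \<open>Completing the square in the distance to \<open>w\<close>.\<close>
    have "0 \<le> (L - a * norm (y - w))\<^sup>2 / (2 * a)" using a by simp
    also have "\<dots> = L\<^sup>2 / (2 * a) - L * norm (y - w) + a / 2 * (norm (y - w))\<^sup>2"
      using a by (simp add: power2_eq_square field_simps)
    finally show ?thesis using F_lower[of y] by linarith
  qed
  ultimately obtain p where p: "\<And>y. F p \<le> F y"
    by (rule convex_sublevel_bounded_attains_min) blast
  have sub: "inner (a *\<^sub>R (w - p)) (y - p) \<le> H y - H p" for y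
  proof -
    define D where "D = H y - H p + a * inner (p - w) (y - p)"
    define Q where "Q = a / 2 * (norm (y - p))\<^sup>2"
    \<comment> \<open>First-order optimality: compare \<open>p\<close> with the point at parameter
      \<open>s\<close> on the way to \<open>y\<close>, divide by \<open>s\<close> and let
      \<open>s\<close> tend to 0 from the right. The limit D \<ge> 0 is the subgradient inequality
      at \<open>p\<close>.\<close>
    have "0 \<le> D + s * Q" if s: "0 < s" "s \<le> 1" for s
    proof -
      have eq: "(1 - s) *\<^sub>R p + s *\<^sub>R y = p + s *\<^sub>R (y - p)" by (simp add: algebra_simps)
      have "H (p + s *\<^sub>R (y - p)) \<le> (1 - s) * H p + s * H y"
        using conv s unfolding convex_on_def eq[symmetric] by auto
      moreover have "(norm (p + s *\<^sub>R (y - p) - w))\<^sup>2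
          = (norm (p - w))\<^sup>2 + 2 * s * inner (p - w) (y - p) + s\<^sup>2 * (norm (y - p))\<^sup>2"
        unfolding power2_norm_eq_inner power2_eq_square[of s] by (simp add: algebra_simps inner_commute)
      ultimately have "F (p + s *\<^sub>R (y - p)) \<le> (1 - s) * H p + s * H y + a / 2 *
        ((norm (p - w))\<^sup>2 + 2 * s * inner (p - w) (y - p) + s\<^sup>2 * (norm (y - p))\<^sup>2)"
        unfolding F_def by simp
      also have "\<dots> = F p + s * (D + s * Q)"
        unfolding F_def D_def Q_def by (simp add: power2_eq_square algebra_simps)
      finally have "0 \<le> s * (D + s * Q)" using p[of "p + s *\<^sub>R (y - p)"] by linarith
      then show ?thesis using s by (simp add: zero_le_mult_iff)
    qed
    then have "\<forall>\<^sub>F s in at_right 0. 0 \<le> D + s * Q"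
      by (auto simp: eventually_at_right[of 0 1] intro!: exI[of _ 1])
    moreover have "((\<lambda>s. D + s * Q) \<longlongrightarrow> D + 0 * Q) (at_right 0)"
      by (intro tendsto_intros)
    ultimately have "0 \<le> D + 0 * Q"
      using tendsto_lowerbound trivial_limit_at_right_real by blast
    then show ?thesis unfolding D_def by (simp add: algebra_simps)
  qed
  \<comment> \<open>Moving the base point from \<open>p\<close> to \<open>w\<close> costs at most L
    d in the values of \<open>H\<close> and gains a d^2 in the inner product; the choice of
    \<open>a\<close> keeps the net cost below \<open>e\<close>.\<close>
  have "inner (a *\<^sub>R (w - p)) (y - w) \<le> H y - H w + e" for y
  proof -
    define d where "d = norm (p - w)"
    have "inner (a *\<^sub>R (w - p)) (y - w) = inner (a *\<^sub>R (w - p)) (y - p) - a * d\<^sup>2"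
      unfolding d_def by (simp add: power2_norm_eq_inner algebra_simps inner_commute)
    moreover have "H w - H p \<le> L * d" using lower[of p] unfolding d_def by linarith
    moreover have "L * d - a * d\<^sup>2 \<le> e"
    proof -
      have "4 * a * (e - L * d + a * d\<^sup>2) = (2 * a * d - L)\<^sup>2 + 1"
        using ae by (simp add: power2_eq_square algebra_simps)
      also have "\<dots> \<ge> 0" by simp
      finally show ?thesis using a by (simp add: zero_le_mult_iff)
    qed
    ultimately show ?thesis using sub[of y] by linarith
  qed
  then show ?thesis using that by blast
qed

section \<open>Criticality as a limit, and the \<epsilon>-subdifferentials of
  \<open>h\<close>\<close>

text \<open>The intersections with slack 1/(n+1) form a nest, bounded through its \<open>h\<close>
  part. Used in contrapositive form: at a noncritical point the two \<delta>-subdifferentials are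
  disjoint for some \<delta> > 0.\<close>

lemma critical_pointI_eps:
  fixes g h :: "'a::{real_inner,complete_space} \<Rightarrow> ereal"
  assumes bdd: "bounded (eps_subdifferential 1 h w)"
    and ne: "\<And>\<delta>. \<delta> > 0 \<Longrightarrow> eps_subdifferential \<delta> g w \<inter> eps_subdifferential \<delta> h w \<noteq> {}"
  shows "critical_point g h w"
proof -
  define K where
    "K n = eps_subdifferential (1 / Suc n) g w \<inter> eps_subdifferential (1 / Suc n) h w" for n
  have "closed (K n)" "convex (K n)" for n
    unfolding K_def by (intro closed_Int convex_Int eps_subdifferential_closed_convex)+
  moreover have "K n \<noteq> {}" for n unfolding K_def by (intro ne) auto
  moreover have "K n \<subseteq> K m" if "m \<le> n" for m n
  proof -
    have "1 / real (Suc n) \<le> 1 / real (Suc m)" using that by (intro divide_left_mono) auto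
    then show ?thesis unfolding K_def by (intro Int_mono eps_subdifferential_mono)
  qed
  moreover have "bounded (K 0)"
    unfolding K_def by (rule bounded_subset[OF bdd]) simp
  ultimately obtain v where v: "\<And>n. v \<in> K n"
    using nested_closed_convex_common_point[of K] by metis
  have "v \<in> subdifferential g w"
    by (rule subdifferential_eq_INT) (use v in \<open>auto simp: K_def\<close>)
  moreover have "v \<in> subdifferential h w"
    by (rule subdifferential_eq_INT) (use v in \<open>auto simp: K_def\<close>)
  ultimately show ?thesis unfolding critical_point_def by blast
qed

lemma proper_fun_UNIV_real:
  assumes "proper_fun h" "edom h = UNIV"
  obtains H where "h = (\<lambda>x. ereal (H x))"
proof -
  have "\<bar>h x\<bar> \<noteq> \<infinity>" for x
    using assms unfolding proper_fun_def edom_def by (cases "h x") auto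
  then have "h = (\<lambda>x. ereal (real_of_ereal (h x)))" by (simp add: ereal_real')
  then show ?thesis by (rule that)
qed

text \<open>Guarantees that Step 2 can always be executed. The bound of \<open>h\<close> on a unit
  ball feeds the proximal construction.\<close>

lemma eps_subdifferential_nonempty:
  fixes h :: "'a::{real_inner,complete_space} \<Rightarrow> ereal"
  assumes "proper_fun h" "edom h = UNIV" and conv: "convex_fun h" and cont: "continuous_on UNIV h"
    and bdd: "\<And>B. bounded B \<Longrightarrow> \<exists>M::real. \<forall>x\<in>B. \<bar>h x\<bar> \<le> ereal M" and "e > 0"
  shows "eps_subdifferential e h w \<noteq> {}"
proof -
  obtain H where H: "h = (\<lambda>x. ereal (H x))" using assms(1,2) by (rule proper_fun_UNIV_real)
  have "convex_on UNIV H"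
    unfolding convex_on_def
  proof clarsimp
    fix x y and s t :: real assume "0 \<le> s" "0 \<le> t" "s + t = 1"
    then have t: "t = 1 - s" and s: "s \<in> {0..1}" by auto
    show "H (s *\<^sub>R x + t *\<^sub>R y) \<le> s * H x + t * H y"
      using conv s unfolding convex_fun_def H t by fastforce
  qed
  moreover have "continuous_on UNIV H"
    using cont unfolding H by (simp add: continuous_on_iff_real o_def)
  moreover obtain M where M: "\<forall>x\<in>cball w 1. \<bar>h x\<bar> \<le> ereal M" using bdd[of "cball w 1"] by auto
  have "H z \<le> M" if "norm (z - w) = 1" for z
  proof -
    have "z \<in> cball w 1" using that by (simp add: dist_norm norm_minus_commute)
    then show ?thesis using M unfolding H by force
  qed
  ultimately obtain v where "\<And>y. inner v (y - w) \<le> H y - H w + e"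
    using convex_on_eps_subgradient_exists[of H w M e] \<open>e > 0\<close> by metis
  then have "v \<in> eps_subdifferential e h w" unfolding eps_subdifferential_def edom_def H by simp
  then show ?thesis by blast
qed

text \<open>Testing \<open>v\<close> at the point at distance 1 from \<open>w\<close> in the
  direction of \<open>v\<close> bounds its norm by the rise of \<open>h\<close> on the unit ball
  plus \<open>e\<close>.\<close>

lemma eps_subdifferential_bounded:
  assumes "proper_fun h" "edom h = UNIV"
    and bdd: "\<And>B. bounded B \<Longrightarrow> \<exists>M::real. \<forall>x\<in>B. \<bar>h x\<bar> \<le> ereal M"
  shows "bounded (eps_subdifferential e h w)"
proof -
  obtain H where H: "h = (\<lambda>x. ereal (H x))" using assms(1,2) by (rule proper_fun_UNIV_real)
  obtain M where M: "\<forall>x\<in>cball w 1. \<bar>h x\<bar> \<le> ereal M" using bdd[of "cball w 1"] by auto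
  have "norm v \<le> max 0 (M - H w + e)" if v: "v \<in> eps_subdifferential e h w" for v
  proof (cases "v = 0")
    case False
    define z where "z = w + (1 / norm v) *\<^sub>R v"
    have "inner v (z - w) \<le> H z - H w + e"
      using v unfolding eps_subdifferential_def H by simp
    moreover have "inner v (z - w) = norm v"
      unfolding z_def using False by (simp add: power2_norm_eq_inner[symmetric] power2_eq_square)
    moreover have "z \<in> cball w 1" unfolding z_def using False by (simp add: dist_norm)
    then have "H z \<le> M" using M unfolding H by force
    ultimately show ?thesis by linarith
  qed simp
  then show ?thesis unfolding bounded_iff by blast
qed

section \<open>Approximate minimisers of the convex subproblem\<close>

text \<open>The infimum is finite, so adding \<open>e\<close> strictly raises it. Guarantees that
  Step 3 can be executed.\<close>

lemma eps_solution_exists: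
  fixes \<phi> :: "'a \<Rightarrow> ereal"
  assumes "\<And>x. ereal b \<le> \<phi> x" "\<phi> x0 < \<infinity>" "e > 0"
  obtains u where "eps_solution e \<phi> u"
proof -
  have "ereal b \<le> (INF x. \<phi> x)" using assms(1) by (intro INF_greatest) auto
  moreover have "(INF x. \<phi> x) < \<infinity>" using assms(2) INF_lower[of x0 UNIV \<phi>] by auto
  ultimately have "(INF x. \<phi> x) < (INF x. \<phi> x) + ereal e"
    using assms(3) by (cases "INF x. \<phi> x") auto
  then obtain u where "\<phi> u < (INF x. \<phi> x) + ereal e" unfolding INF_less_iff by blast
  then show ?thesis using that unfolding eps_solution_def by (blast intro: less_imp_le)
qed

lemma eps_solutionD: "eps_solution e \<phi> u \<Longrightarrow> \<phi> u \<le> \<phi> x + ereal e"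
  unfolding eps_solution_def
  by (meson INF_lower UNIV_I add_right_mono order_trans)

text \<open>An \<epsilon>-solution \<open>u\<close> makes \<open>v\<close> an \<epsilon>-subgradient
  at \<open>u\<close>. Passing to \<open>w\<close> has three costs, each at most \<delta>/3: the
  drop of \<open>g\<close> from \<open>w\<close> to \<open>u\<close>, the inner product of
  \<open>v\<close> with u - w, and \<open>e\<close> itself.\<close>

lemma lsc_eps_solution_near_imp_eps_subgradient:
  fixes g :: "'a::real_inner \<Rightarrow> ereal"
  assumes proper: "proper_fun g" and lsc: "lsc_fun g" and w: "g w < \<infinity>" and \<delta>: "\<delta> > 0"
    and B: "B \<ge> 0"
  obtains r where "r > 0"
    "\<And>u v e. norm (u - w) < r \<Longrightarrow> norm v \<le> B \<Longrightarrow> e \<le> r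
      \<Longrightarrow> eps_solution e (\<lambda>x. g x - ereal (inner v x)) u \<Longrightarrow> v \<in> eps_subdifferential \<delta> g w"
proof -
  have ninf: "g x \<noteq> -\<infinity>" for x using proper unfolding proper_fun_def by blast
  obtain G where G: "g w = ereal G" using w ninf[of w] by (cases "g w") auto
  have "ereal (G - \<delta> / 3) < g w" using \<delta> G by simp
  also have "g w \<le> Liminf (at w) g" using lsc unfolding lsc_fun_def by blast
  finally have "ereal (G - \<delta> / 3) < Liminf (at w) g" .
  then have "eventually (\<lambda>x. ereal (G - \<delta> / 3) < g x) (at w)" by (rule less_LiminfD)
  then obtain r0 where r0: "r0 > 0"
    "\<And>x. x \<noteq> w \<Longrightarrow> norm (x - w) < r0 \<Longrightarrow> ereal (G - \<delta> / 3) < g x"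
    unfolding eventually_at by (auto simp: dist_norm)
  \<comment> \<open>The filter \<open>at w\<close> is punctured, so \<open>w\<close> itself is added
    by hand.\<close>
  have near: "ereal (G - \<delta> / 3) < g x" if "norm (x - w) < r0" for x
    using r0(2)[of x] that G \<delta> by (cases "x = w") auto
  \<comment> \<open>The factor B + 1 keeps the quotient meaningful when \<open>B\<close> is
    0.\<close>
  define r where "r = min r0 (min (\<delta> / 3) (\<delta> / (3 * (B + 1))))"
  have r: "r > 0" "r \<le> r0" "r \<le> \<delta> / 3" unfolding r_def using r0 \<delta> B by (simp, simp, linarith)
  have "(B + 1) * r \<le> (B + 1) * (\<delta> / (3 * (B + 1)))"
    unfolding r_def using B by (intro mult_left_mono) auto
  also have "\<dots> = \<delta> / 3" using B by (simp add: field_simps)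
  finally have Br: "B * r \<le> \<delta> / 3" using r by (simp add: algebra_simps)
  have "v \<in> eps_subdifferential \<delta> g w"
    if u: "norm (u - w) < r" and v: "norm v \<le> B" and e: "e \<le> r"
      and sol: "eps_solution e (\<lambda>x. g x - ereal (inner v x)) u" for u v e
  proof -
    have "ereal (inner v (x - w)) \<le> g x - g w + ereal \<delta>" for x
    proof (cases "g x")
      case (real X)
      have "g u - ereal (inner v u) \<le> ereal (X - inner v x + e)"
        using eps_solutionD[OF sol, of x] real by simp
      then obtain U where U: "g u = ereal U" "U - inner v u \<le> X - inner v x + e"
        using ninf[of u] by (cases "g u") auto
      have "G - \<delta> / 3 < U" using near[of u] u r U by simp
      moreover have "inner v (u - w) \<le> B * r"
      proof -
        have "inner v (u - w) \<le> norm v * norm (u - w)" by (rule norm_cauchy_schwarz)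
        also have "\<dots> \<le> B * r" using u v B by (intro mult_mono) auto
        finally show ?thesis .
      qed
      ultimately have "inner v (x - w) \<le> X - G + \<delta>"
        using U(2) Br e r(3) by (simp add: inner_diff_right)
      then show ?thesis unfolding real G by simp
    qed (use ninf G in auto)
    then show ?thesis using w unfolding eps_subdifferential_def edom_def by simp
  qed
  then show ?thesis using that r by blast
qed

section \<open>Invariants of the algorithm and its acceptance test\<close>

text \<open>The conditions under which Steps 2 and 3 can be executed. For finite \<open>h\<close>,
  finiteness of \<open>g\<close> is membership in the domain of g - h.\<close>

fun iadca_invariant :: "('a \<Rightarrow> ereal) \<Rightarrow> 'a iadca_state \<Rightarrow> bool" where
  "iadca_invariant g (Step1 k u e) \<longleftrightarrow> 0 < e \<and> g u < \<infinity>"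
| "iadca_invariant g (Step2 k w e) \<longleftrightarrow> 0 < e \<and> g w < \<infinity>"
| "iadca_invariant g (Step3 k w e v) \<longleftrightarrow> 0 < e \<and> g w < \<infinity>"
| "iadca_invariant g (Step4 k w e u) \<longleftrightarrow> 0 < e \<and> g w < \<infinity> \<and> g u < \<infinity>"
| "iadca_invariant g (Step5 k w e u) \<longleftrightarrow> 0 < e \<and> g w < \<infinity> \<and> g u < \<infinity>"

text \<open>Step 1 does not raise g - h, and the value of the subproblem at an \<epsilon>-solution
  exceeds that at \<open>w\<close> by at most \<epsilon>; so the new points stay in the domain of
  \<open>g\<close>.\<close>

lemma iadca_step_invariant:
  assumes h: "proper_fun h" "edom h = UNIV" and \<gamma>: "0 < \<gamma>"
    and step: "iadca_step g h \<gamma> s t" and inv: "iadca_invariant g s"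
  shows "iadca_invariant g t"
proof -
  obtain H where H: "h = (\<lambda>x. ereal (H x))" using h by (rule proper_fun_UNIV_real)
  from step inv show ?thesis
  proof cases
    case (choose_w w u k e)
    then show ?thesis using inv by (cases "g w"; cases "g u") (auto simp: H)
  next
    case (compute_u e v u k w)
    then show ?thesis using inv eps_solutionD[OF compute_u(3), of w]
      by (cases "g w"; cases "g u") auto
  qed (use \<gamma> in auto)
qed

lemma iadca_reachable_invariant:
  assumes h: "proper_fun h" "edom h = UNIV" and \<gamma>: "0 < \<gamma>"
    and "(iadca_step g h \<gamma>)\<^sup>*\<^sup>* s t" "iadca_invariant g s"
  shows "iadca_invariant g t"
  using assms(4,5) by induction (auto intro: iadca_step_invariant[OF h \<gamma>])

text \<open>The last transition into a \<open>Step5\<close> state can only be \<open>accept\<close>,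
  whose guard is the claim.\<close>

lemma iadca_Step5_threshold:
  assumes "(iadca_step g h \<gamma>)\<^sup>*\<^sup>* (Step2 k w e) (Step5 k' w' e' u')"
  shows "ereal e' \<le> step4_threshold g h w' u'"
  using assms by (cases rule: rtranclp.cases) (auto elim: iadca_step.cases)

text \<open>A modulus may be infinite, as for the indicator of a point, so a real number strictly
  below the sum is used.\<close>

lemma step4_threshold_lower:
  assumes "strong_convexity_modulus g + strong_convexity_modulus h > 0"
  obtains c where "c > 0" "\<And>w u. ereal (c * (norm (u - w))\<^sup>2) \<le> step4_threshold g h w u"
proof -
  obtain c where c: "0 < ereal c" "ereal c < strong_convexity_modulus g + strong_convexity_modulus h"
    using assms ereal_dense2 by blast
  have "ereal c / 32 \<le> (strong_convexity_modulus g + strong_convexity_modulus h) / 32"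
    using c(2) by (intro ereal_divide_right_mono) auto
  then have "ereal (c / 32) * ereal ((norm (u - w))\<^sup>2) \<le> step4_threshold g h w u" for w u :: 'a
    unfolding step4_threshold_def by (intro ereal_mult_right_mono) auto
  then show ?thesis using that[of "c / 32"] c(1) by simp
qed

section \<open>Termination of the adaptive loop\<close>

text \<open>Positivity of the sum of the moduli is essential: were it 0, the restart guard would
  hold for every positive \<epsilon>.\<close>

theorem lemma3p3:
  fixes g h :: "'a::{real_inner,complete_space} \<Rightarrow> ereal"
    and u0 w u :: 'a and \<gamma> \<epsilon>0 \<epsilon> :: real and k :: nat
  assumes "proper_fun g" and "lsc_fun g" and "convex_fun g"
    and "proper_fun h" and "lsc_fun h" and "convex_fun h"
    and "edom h = UNIV"
    and "\<And>B. bounded B \<Longrightarrow> \<exists>M::real. \<forall>x\<in>B. \<bar>h x\<bar> \<le> ereal M"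
    and "(INF x. g x - h x) > -\<infinity>"
    and "continuous_on UNIV h"
    and "strong_convexity_modulus g + strong_convexity_modulus h > 0"
    and "u0 \<in> edom (\<lambda>x. g x - h x)"
    and "0 < \<gamma>" and "\<gamma> < 1" and "0 < \<epsilon>0" and "\<epsilon>0 \<le> 1"
    and "(iadca_step g h \<gamma>)\<^sup>*\<^sup>* (Step1 0 u0 \<epsilon>0) (Step1 k u \<epsilon>)"
    and "iadca_step g h \<gamma> (Step1 k u \<epsilon>) (Step2 k w \<epsilon>)"
    and "\<not> critical_point g h w"
  shows "inevitably (iadca_step g h \<gamma>) (\<lambda>s. \<exists>\<epsilon>' u'. s = Step5 k w \<epsilon>' u') (Step2 k w \<epsilon>)
    \<and> (\<forall>\<epsilon>' u'. (iadca_step g h \<gamma>)\<^sup>*\<^sup>* (Step2 k w \<epsilon>) (Step5 k w \<epsilon>' u') \<longrightarrow>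
         ereal \<epsilon>' \<le> (strong_convexity_modulus g + strong_convexity_modulus h) / 32
                     * ereal ((norm (u' - w))\<^sup>2))"
proof
  let ?P = "\<lambda>s. \<exists>\<epsilon>' u'. s = Step5 k w \<epsilon>' u'"
  let ?R = "iadca_step g h \<gamma>"
  note h = \<open>proper_fun h\<close> \<open>edom h = UNIV\<close>
  have g_ninf: "g x \<noteq> -\<infinity>" for x using \<open>proper_fun g\<close> unfolding proper_fun_def by blast
  obtain H where H: "h = (\<lambda>x. ereal (H x))" using h by (rule proper_fun_UNIV_real)
  have "g u0 < \<infinity>" using \<open>u0 \<in> edom _\<close> unfolding edom_def H by (cases "g u0") auto
  then have "iadca_invariant g (Step1 0 u0 \<epsilon>0)" using \<open>0 < \<epsilon>0\<close> by simp
  then have "iadca_invariant g (Step2 k w \<epsilon>)"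
    by (rule iadca_reachable_invariant[OF h \<open>0 < \<gamma>\<close>
          rtranclp.rtrancl_into_rtrancl[OF assms(17,18)]])
  then have \<epsilon>: "\<epsilon> > 0" and gw: "g w < \<infinity>" by auto

  have bdd: "bounded (eps_subdifferential 1 h w)"
    by (rule eps_subdifferential_bounded[OF h assms(8)])
  obtain B0 where B0: "\<And>v. v \<in> eps_subdifferential 1 h w \<Longrightarrow> norm v \<le> B0"
    using bdd unfolding bounded_iff by blast
  define B where "B = max 0 B0"
  obtain \<delta> where \<delta>: "\<delta> > 0" "eps_subdifferential \<delta> g w \<inter> eps_subdifferential \<delta> h w = {}"
    using critical_pointI_eps[OF bdd] \<open>\<not> critical_point g h w\<close> by blast
  obtain r where r: "r > 0"
    "\<And>u v e. norm (u - w) < r \<Longrightarrow> norm v \<le> B \<Longrightarrow> e \<le> r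
      \<Longrightarrow> eps_solution e (\<lambda>x. g x - ereal (inner v x)) u \<Longrightarrow> v \<in> eps_subdifferential \<delta> g w"
    using lsc_eps_solution_near_imp_eps_subgradient
      [OF \<open>proper_fun g\<close> \<open>lsc_fun g\<close> gw \<delta>(1), of B] unfolding B_def by auto
  obtain c where c: "c > 0"
    "\<And>w u. ereal (c * (norm (u - w))\<^sup>2) \<le> step4_threshold g h w u"
    using step4_threshold_lower[OF assms(11)] by blast
  \<comment> \<open>For e \<le> \<eta>: the bound 1 gives norm v \<le> B, the bound \<delta> puts
    \<open>v\<close> into the \<delta>-subdifferential of \<open>h\<close>, \<open>r\<close> limits
    the error of the subproblem, and c r^2 forces a rejected \<open>u'\<close> to lie within
    \<open>r\<close> of \<open>w\<close>.\<close>
  define \<eta> where "\<eta> = min (min 1 \<delta>) (min r (c * r\<^sup>2))"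
  have \<eta>: "\<eta> > 0" unfolding \<eta>_def using \<delta> r c by simp

  have no_restart: "\<not> ereal e > step4_threshold g h w u'"
    if e: "e \<le> \<eta>" and v: "v \<in> eps_subdifferential e h w"
      and sol: "eps_solution e (\<lambda>x. g x - ereal (inner v x)) u'" for e v u'
  proof
    assume "ereal e > step4_threshold g h w u'"
    then have "ereal (c * (norm (u' - w))\<^sup>2) < ereal e"
      using c(2) by (rule order_le_less_trans[rotated])
    then have "c * (norm (u' - w))\<^sup>2 < c * r\<^sup>2" using e unfolding \<eta>_def by simp
    then have "(norm (u' - w))\<^sup>2 < r\<^sup>2" using c(1) by simp
    then have "norm (u' - w) < r" using r(1) by (simp add: power2_less_imp_less)
    moreover have "v \<in> eps_subdifferential 1 h w" "v \<in> eps_subdifferential \<delta> h w"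
      using v e eps_subdifferential_mono[of e _ h w] unfolding \<eta>_def by auto
    moreover from this have "norm v \<le> B" using B0[of v] unfolding B_def by simp
    ultimately show False using r(2)[of u' v e] sol e \<delta>(2) unfolding \<eta>_def by auto
  qed

  obtain b where b: "ereal b < (INF x. g x - h x)"
    using assms(9) ereal_dense2 by blast
  \<comment> \<open>The \<epsilon>-subgradient inequality for \<open>h\<close> bounds the subproblem
    below by g - h plus a constant, so its infimum is finite.\<close>
  have lower: "ereal (b + H w - inner v w - e) \<le> g x - ereal (inner v x)"
    if "v \<in> eps_subdifferential e h w" for v e x
  proof -
    have "inner v (x - w) \<le> H x - H w + e"
      using that unfolding eps_subdifferential_def H by simp
    moreover have "ereal b < g x - ereal (H x)"
      using b INF_lower[of x UNIV "\<lambda>x. g x - h x"] unfolding H by (auto intro: less_le_trans)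
    ultimately show ?thesis using g_ninf[of x] by (cases "g x") (auto simp: inner_diff_right)
  qed

  \<comment> \<open>One pass through Steps 2 to 4. The next pass is assumed to succeed only for e >
    \<eta>, since below \<eta> no restart occurs.\<close>
  have round: "inevitably ?R ?P (Step2 k w e)"
    if e: "0 < e" and next_round: "\<eta> < e \<Longrightarrow> inevitably ?R ?P (Step2 k w (\<gamma> * e))" for e
  proof (rule inevitably.progress)
    show "\<exists>t. ?R (Step2 k w e) t"
      using eps_subdifferential_nonempty[OF h \<open>convex_fun h\<close> assms(10,8) e]
      by (blast intro: iadca_step.compute_v)
  next
    fix t assume "?R (Step2 k w e) t"
    then obtain v where t: "t = Step3 k w e v" and v: "v \<in> eps_subdifferential e h w"
      by (auto elim: iadca_step.cases)
    show "inevitably ?R ?P t"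
      unfolding t
    proof (rule inevitably.progress)
      have "g w - ereal (inner v w) < \<infinity>" using gw by (cases "g w") auto
      then obtain u' where "eps_solution e (\<lambda>x. g x - ereal (inner v x)) u'"
        using eps_solution_exists[of _ "\<lambda>x. g x - ereal (inner v x)", OF lower[OF v] _ e] by blast
      then show "\<exists>t. ?R (Step3 k w e v) t" by (blast intro: iadca_step.compute_u)
    next
      fix t assume "?R (Step3 k w e v) t"
      then obtain u' where t: "t = Step4 k w e u'"
        and sol: "eps_solution e (\<lambda>x. g x - ereal (inner v x)) u'"
        by (auto elim: iadca_step.cases)
      show "inevitably ?R ?P t"
        unfolding t
      proof (rule inevitably.progress)
        show "\<exists>t. ?R (Step4 k w e u') t"
          by (cases "ereal e > step4_threshold g h w u'") (blast intro: iadca_step.intros)+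
      next
        fix t assume "?R (Step4 k w e u') t"
        then show "inevitably ?R ?P t"
        proof cases
          case restart
          then have "\<eta> < e" using no_restart[OF _ v sol] by force
          then show ?thesis using next_round restart(1) by simp
        qed (auto intro: inevitably.reached)
      qed
    qed
  qed
  \<comment> \<open>Here \<open>n\<close> bounds the number of restarts; for n = 0 the assumption of
    \<open>round\<close> is vacuous.\<close>
  have main: "inevitably ?R ?P (Step2 k w e)" if "0 < e" "e * \<gamma> ^ n \<le> \<eta>" for e n
    using that
  proof (induction n arbitrary: e)
    case 0
    then show ?case using round[of e] by simp
  next
    case (Suc n)
    then have "inevitably ?R ?P (Step2 k w (\<gamma> * e))"
      using \<open>0 < \<gamma>\<close> by (intro Suc.IH) (simp_all add: mult_ac)
    then show ?case using round[of e] \<open>0 < e\<close> by blast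
  qed
  obtain n where "\<gamma> ^ n < \<eta> / \<epsilon>"
    using real_arch_pow_inv[of "\<eta> / \<epsilon>" \<gamma>] \<eta> \<epsilon> \<open>\<gamma> < 1\<close> by auto
  then have "\<epsilon> * \<gamma> ^ n \<le> \<eta>" using \<epsilon> by (simp add: field_simps)
  then show "inevitably ?R ?P (Step2 k w \<epsilon>)" using main \<epsilon> by blast
next
  show "\<forall>\<epsilon>' u'. (iadca_step g h \<gamma>)\<^sup>*\<^sup>* (Step2 k w \<epsilon>) (Step5 k w \<epsilon>' u') \<longrightarrow>
         ereal \<epsilon>' \<le> (strong_convexity_modulus g + strong_convexity_modulus h) / 32
                     * ereal ((norm (u' - w))\<^sup>2)"
    using iadca_Step5_threshold unfolding step4_threshold_def by blast
qed

end
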